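(* Let $\mathcal{P}$ be a common/innovation component joint sparsity model for $J$ signals of length $N$, and let $X\in\mathbb{R}^{JN}$ be a signal ensemble obtained from $\mathcal{P}$. Let $(M_1,\dots,M_J)$ be a tuple of numbers of measurements, let $\Phi_j$, $j\in\Lambda=\{1,\dots,J\}$, be random $M_j\times N$ matrices with i.i.d. Gaussian entries (independent across $j$), let $\Phi=\mathrm{diag}(\Phi_1,\dots,\Phi_J)$ be the block-diagonal matrix, and write $Y=\Phi X$. Suppose there exists a full rank location matrix $P\in\mathcal{P}_F(X)$ such that $$\sum_{j\in\Gamma} M_j\ \ge\ K_{\mathrm{cond}}(\Gamma,P)\qquad\text{for all }\Gamma\subseteq\Lambda .$$ Then with probability one over $\{\Phi_j\}_{j\in\Lambda}$ there exists a unique solution $\widehat\Theta$ to the system of equations $Y=\Phi P\widehat\Theta$; hence the signal ensemble $X$ can be uniquely recovered as $X=P\widehat\Theta$.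
   Context: Signals $x_1,\dots,x_J\in\mathbb{R}^N$ are stacked as $X=[x_1^T\ \cdots\ x_J^T]^T\in\mathbb{R}^{JN}$; sensor $j$ observes $y_j=\Phi_jx_j$, and $Y=[y_1^T\ \cdots\ y_J^T]^T=\Phi X$. An identity submatrix is a matrix whose columns are distinct columns of the $N\times N$ identity matrix (possibly with no columns). A common/innovation component joint sparsity model is a set $\mathcal{P}$ of location matrices of the form $$P=\begin{bmatrix}P_C&P_1&0&\cdots&0\\P_C&0&P_2&\cdots&0\\ \vdots&\vdots&\vdots&\ddots&\vdots\\P_C&0&0&\cdots&P_J\end{bmatrix},$$ where $P_C$ ($N\times K_C(P)$) and $P_j$ ($N\times K_j(P)$), $j\in\Lambda$, are identity submatrices. It models $x_j=z_C+z_j$ with common component $z_C=P_C\theta_C$ and innovations $z_j=P_j\theta_j$. The ensemble $X$ is obtained from $\mathcal{P}$ if $X=P\Theta$ for some $P\in\mathcal{P}$ and some vector $\Theta$. $\mathcal{P}_F(X)\subseteq\mathcal{P}$ is the set of those $P\in\mathcal{P}$ for which there is a vector $\Theta=[\theta_C^T\ \theta_1^T\cdots\theta_J^T]^T$ with $X=P\Theta$. "Full rank" means full column rank. For $\Gamma\subseteq\Lambda$, the overlap size $K_C(\Gamma,P)$ is the number of indices $n\in\{1,\dots,N\}$ such that the $n$-th canonical unit vector is a column of $P_C$ and is a column of $P_j$ for every $j\notin\Gamma$; moreover $K_C(\Lambda,P)=K_C(P)$ and $K_C(\emptyset,P)=0$ by convention. The conditional sparsity is $K_{\mathrm{cond}}(\Gamma,P)=\big(\sum_{j\in\Gamma}K_j(P)\big)+K_C(\Gamma,P)$.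 Gaussian entries are zero-mean with positive variance. *)

theory Defs
  imports "HOL-Probability.Probability" "Jordan_Normal_Form.DL_Rank"
begin

text \<open>
  Sensors are indexed by \<open>{..<J}\<close> and coordinates by \<open>{..<N}\<close>. A location matrix is kept
  together with its blocks, since the numbers \<open>K\<^sub>C(P)\<close>, \<open>K\<^sub>j(P)\<close> and \<open>K\<^sub>C(\<Gamma>,P)\<close> refer to the blocks
  and, for \<open>J = 1\<close>, the blocks cannot be read off from the assembled matrix. Only the
  innovation blocks with index below \<open>J\<close> are meaningful.
\<close>

record location =
  common :: "real mat"
  innov :: "nat \<Rightarrow> real mat"

definition identity_submatrix :: "nat \<Rightarrow> real mat \<Rightarrow> bool" where
  "identity_submatrix N A \<longleftrightarrow>
     dim_row A = N \<and> set (cols A) \<subseteq> set (cols (1\<^sub>m N :: real mat)) \<and> distinct (cols A)"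

definition is_location :: "nat \<Rightarrow> nat \<Rightarrow> location \<Rightarrow> bool" where
  "is_location J N P \<longleftrightarrow>
     identity_submatrix N (common P) \<and> (\<forall>j<J. identity_submatrix N (innov P j))"

definition joint_sparsity_model :: "nat \<Rightarrow> nat \<Rightarrow> location set \<Rightarrow> bool" where
  "joint_sparsity_model J N \<P> \<longleftrightarrow> (\<forall>P\<in>\<P>. is_location J N P)"

definition append_cols :: "real mat \<Rightarrow> real mat \<Rightarrow> real mat" where
  "append_cols A B = four_block_mat A B (0\<^sub>m 0 (dim_col A)) (0\<^sub>m 0 (dim_col B))"

definition stack_copies :: "nat \<Rightarrow> real mat \<Rightarrow> real mat" where
  "stack_copies J A = foldr (@\<^sub>r) (replicate J A) (0\<^sub>m 0 (dim_col A))"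

definition location_matrix :: "nat \<Rightarrow> location \<Rightarrow> real mat" where
  "location_matrix J P =
     append_cols (stack_copies J (common P)) (diag_block_mat (map (innov P) [0..<J]))"

definition full_column_rank :: "real mat \<Rightarrow> bool" where
  "full_column_rank A \<longleftrightarrow> vec_space.rank (dim_row A) A = dim_col A"

definition generates :: "nat \<Rightarrow> location \<Rightarrow> real vec \<Rightarrow> bool" where
  "generates J P X \<longleftrightarrow>
     (\<exists>\<Theta> \<in> carrier_vec (dim_col (location_matrix J P)). X = location_matrix J P *\<^sub>v \<Theta>)"

definition obtained_from :: "nat \<Rightarrow> location set \<Rightarrow> real vec \<Rightarrow> bool" where
  "obtained_from J \<P> X \<longleftrightarrow> (\<exists>P\<in>\<P>. generates J P X)"

definition feasible_locations :: "nat \<Rightarrow> location set \<Rightarrow> real vec \<Rightarrow> location set" where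
  "feasible_locations J \<P> X = {P \<in> \<P>. generates J P X}"

definition overlap_size :: "nat \<Rightarrow> nat \<Rightarrow> nat set \<Rightarrow> location \<Rightarrow> nat" where
  "overlap_size J N \<Gamma> P =
     (if \<Gamma> = {} then 0
      else if \<Gamma> = {..<J} then dim_col (common P)
      else card {n. n < N \<and> unit_vec N n \<in> set (cols (common P)) \<and>
                    (\<forall>j\<in>{..<J} - \<Gamma>. unit_vec N n \<in> set (cols (innov P j)))})"

definition cond_sparsity :: "nat \<Rightarrow> nat \<Rightarrow> nat set \<Rightarrow> location \<Rightarrow> nat" where
  "cond_sparsity J N \<Gamma> P = (\<Sum>j\<in>\<Gamma>. dim_col (innov P j)) + overlap_size J N \<Gamma> P"

text \<open>
  Joint independence of all entries of all matrices gives both the independence within each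
  matrix and the independence across sensors; the variance may depend on the sensor.
\<close>

definition gaussian_measurements ::
  "'w measure \<Rightarrow> nat \<Rightarrow> nat \<Rightarrow> (nat \<Rightarrow> nat) \<Rightarrow> (nat \<Rightarrow> 'w \<Rightarrow> real mat) \<Rightarrow> bool" where
  "gaussian_measurements \<Omega> J N M \<Phi> \<longleftrightarrow>
     (\<forall>j<J. \<forall>\<omega>\<in>space \<Omega>. \<Phi> j \<omega> \<in> carrier_mat (M j) N) \<and>
     (\<forall>j<J. \<exists>\<sigma>>0. \<forall>i<M j. \<forall>n<N.
        distributed \<Omega> lborel (\<lambda>\<omega>. \<Phi> j \<omega> $$ (i, n)) (normal_density 0 \<sigma>)) \<and>
     prob_space.indep_vars \<Omega> (\<lambda>_. borel) (\<lambda>(j, i, n) \<omega>. \<Phi> j \<omega> $$ (i, n))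
       {(j, i, n). j < J \<and> i < M j \<and> n < N}"

definition measurement_matrix :: "nat \<Rightarrow> (nat \<Rightarrow> 'w \<Rightarrow> real mat) \<Rightarrow> 'w \<Rightarrow> real mat" where
  "measurement_matrix J \<Phi> \<omega> = diag_block_mat (map (\<lambda>j. \<Phi> j \<omega>) [0..<J])"

end

theory Submission
  imports Defs
begin

text \<open>
  Existence of a solution is clear, so the point is that \<open>\<Phi> P\<close> has trivial kernel almost surely.
  Join every column of \<open>P\<close> to the measurements that may identify it: an innovation column of
  sensor \<open>j\<close> to the measurements of sensor \<open>j\<close>, a common column with coordinate \<open>n\<close> to
  the measurements of all sensors without an innovation at \<open>n\<close>. The inequalities on the conditional
  sparsities are then Hall's condition, except that full rank is needed for \<open>\<Gamma> = {}\<close>, so all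
  columns can be matched to distinct measurements. The square submatrix of \<open>\<Phi> P\<close> given by the
  matched rows has a determinant which is affine in every single entry of \<open>\<Phi>\<close> and nonzero
  for a suitable 0/1 choice of \<open>\<Phi>\<close>; by Fubini it is nonzero almost surely.
\<close>

subsection \<open>Hall's marriage theorem\<close>

text \<open>Induction on \<open>card I\<close>. If some proper nonempty \<open>L\<close> is tight,
  meaning that the union of its sets has exactly \<open>card L\<close> elements, then
  \<open>L\<close> is matched inside this union and the remaining indices outside it. Otherwise
  every proper nonempty subset has an element to spare, so any \<open>i\<close> may take any
  \<open>x\<close> in \<open>A i\<close>, and \<open>x\<close> is removed from the other
  sets.\<close>

theorem hall_marriage:
  fixes A :: "'a \<Rightarrow> 'b set"
  assumes "finite I" and "\<And>i. i \<in> I \<Longrightarrow> finite (A i)"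
    and "\<And>L. L \<subseteq> I \<Longrightarrow> card L \<le> card (\<Union>(A ` L))"
  shows "\<exists>R. inj_on R I \<and> (\<forall>i\<in>I. R i \<in> A i)"
  using assms
proof (induction "card I" arbitrary: I A rule: less_induct)
  case less
  note fin = less.prems(1,2) and hall = less.prems(3)
  have finU: "finite (\<Union>(A ` L))" if "L \<subseteq> I" for L
  proof -
    have "finite L" using that fin(1) by (rule finite_subset)
    then show ?thesis using that fin(2) by blast
  qed
  show ?case
  proof (cases "I = {}")
    case False
    then obtain i where i: "i \<in> I" by blast
    show ?thesis
    proof (cases "\<exists>L. L \<subset> I \<and> L \<noteq> {} \<and> card (\<Union>(A ` L)) = card L")
      case True
      then obtain L where L: "L \<subset> I" "L \<noteq> {}" "card (\<Union>(A ` L)) = card L" by blast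
      define U where "U = \<Union>(A ` L)"
      have finL: "finite L" using L(1) fin(1) finite_subset by blast
      have "\<exists>R. inj_on R L \<and> (\<forall>i\<in>L. R i \<in> A i)"
      proof (rule less.hyps)
        show "card L < card I" using L(1) fin(1) psubset_card_mono by blast
        show "finite (A i)" if "i \<in> L" for i using that L(1) fin(2) by blast
        show "card T \<le> card (\<Union>(A ` T))" if "T \<subseteq> L" for T
          using that L(1) by (intro hall) blast
      qed (rule finL)
      then obtain R1 where R1: "inj_on R1 L" "\<forall>i\<in>L. R1 i \<in> A i" by blast
      \<comment> \<open>Hall's condition survives the removal of \<open>U\<close>: apply it to
        \<open>T \<union> L\<close> and cancel \<open>card L = card U\<close>.\<close>
      have "card T \<le> card (\<Union>((\<lambda>i. A i - U) ` T))" if T: "T \<subseteq> I - L" for T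
      proof -
        have finT: "finite T" using T fin(1) finite_subset by blast
        have "card T + card L = card (T \<union> L)"
          using T finL finT by (intro card_Un_disjoint[symmetric]) auto
        also have "\<dots> \<le> card (\<Union>(A ` (T \<union> L)))" using T L(1) by (intro hall) auto
        also have "\<Union>(A ` (T \<union> L)) = \<Union>((\<lambda>i. A i - U) ` T) \<union> U" by (auto simp: U_def)
        also have "card \<dots> \<le> card (\<Union>((\<lambda>i. A i - U) ` T)) + card U" by (rule card_Un_le)
        finally show ?thesis using L(3) by (simp add: U_def)
      qed
      then have "\<exists>R. inj_on R (I - L) \<and> (\<forall>i\<in>I - L. R i \<in> A i - U)"
        using L fin by (intro less.hyps psubset_card_mono) auto
      then obtain R2 where R2: "inj_on R2 (I - L)" "\<forall>i\<in>I - L. R2 i \<in> A i - U" by blast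
      define R where "R = (\<lambda>i. if i \<in> L then R1 i else R2 i)"
      have "R1 a \<noteq> R2 b" if "a \<in> L" "b \<in> I - L" for a b
        using R1(2) R2(2) that by (auto simp: U_def)
      then have "inj_on R I"
        using R1(1) R2(1) unfolding inj_on_def R_def by (metis DiffI)
      moreover have "\<forall>i\<in>I. R i \<in> A i" using R1 R2 by (auto simp: R_def)
      ultimately show ?thesis by blast
    next
      case False
      have "card {i} \<le> card (A i)" using hall[of "{i}"] i by simp
      then obtain x where x: "x \<in> A i" by fastforce
      \<comment> \<open>With no tight proper subset, the strict inequality absorbs the loss of the
        single element \<open>x\<close>.\<close>
      have "card T \<le> card (\<Union>((\<lambda>j. A j - {x}) ` T))" if T: "T \<subseteq> I - {i}" for T
      proof (cases "T = {}")
        case ne: False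
        have TI: "T \<subset> I" using T i by blast
        then have sub: "T \<subseteq> I" by simp
        have "card (\<Union>(A ` T)) \<noteq> card T" using False TI ne by blast
        then have "card T < card (\<Union>(A ` T))" using hall[OF sub] by simp
        also have "\<dots> \<le> card (insert x (\<Union>((\<lambda>j. A j - {x}) ` T)))"
          using finU[OF sub] by (intro card_mono) (auto intro: finite_subset)
        also have "\<dots> \<le> Suc (card (\<Union>((\<lambda>j. A j - {x}) ` T)))"
          by (rule card_insert_le_m1) simp_all
        finally show ?thesis by simp
      qed simp
      then have "\<exists>R. inj_on R (I - {i}) \<and> (\<forall>j\<in>I - {i}. R j \<in> A j - {x})"
        using i fin by (intro less.hyps psubset_card_mono) auto
      then obtain R where R: "inj_on R (I - {i})" "\<forall>j\<in>I - {i}. R j \<in> A j - {x}" by blast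
      have "inj_on (R(i := x)) I"
        using R unfolding inj_on_def by (metis Diff_iff fun_upd_apply singleton_iff)
      moreover have "\<forall>j\<in>I. (R(i := x)) j \<in> A j" using R x by auto
      ultimately show ?thesis by blast
    qed
  qed auto
qed

subsection \<open>Zeros of multiaffine functions\<close>

text \<open>Interpolation between the values at 0 and 1 expresses affineness in one coordinate
  without mentioning polynomials. Intercept and slope are built from values of \<open>f\<close>, so
  inductions over the coordinates can be applied to them.\<close>

definition affine_coord :: "'i \<Rightarrow> (('i \<Rightarrow> real) \<Rightarrow> real) \<Rightarrow> bool" where
  "affine_coord i f \<longleftrightarrow>
     (\<forall>x t. f (x(i := t)) = f (x(i := 0)) + t * (f (x(i := 1)) - f (x(i := 0))))"

lemma affine_coordD:
  "affine_coord i f \<Longrightarrow> f (x(i := t)) = f (x(i := 0)) + t * (f (x(i := 1)) - f (x(i := 0)))"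
  unfolding affine_coord_def by blast

lemma affine_coord_fix:
  assumes "affine_coord j f" "i \<noteq> j"
  shows "affine_coord j (\<lambda>x. f (x(i := a)))"
  unfolding affine_coord_def
proof (intro allI)
  fix x t
  show "f (x(j := t, i := a)) = f (x(j := 0, i := a)) + t * (f (x(j := 1, i := a)) - f (x(j := 0, i := a)))"
    using affine_coordD[OF assms(1), of "x(i := a)" t] assms(2) by (simp add: fun_upd_twist)
qed

lemma affine_coord_diff:
  assumes "affine_coord j f" "affine_coord j g"
  shows "affine_coord j (\<lambda>x. f x - g x)"
  unfolding affine_coord_def
proof (intro allI)
  fix x t
  show "f (x(j := t)) - g (x(j := t)) = f (x(j := 0)) - g (x(j := 0)) +
     t * (f (x(j := 1)) - g (x(j := 1)) - (f (x(j := 0)) - g (x(j := 0))))"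
    unfolding affine_coordD[OF assms(1), of x t] affine_coordD[OF assms(2), of x t]
    by (simp add: algebra_simps)
qed

text \<open>Write \<open>f x = h x + x i * g x\<close>, where \<open>g\<close> and \<open>h\<close>
  do not look at coordinate \<open>i\<close> and are again affine in each remaining coordinate; they
  are measurable by induction.\<close>

lemma measurable_multiaffine:
  assumes "finite I" and "\<And>i. i \<in> I \<Longrightarrow> affine_coord i f"
    and sets: "\<And>i. i \<in> I \<Longrightarrow> sets (\<mu> i) = sets borel"
  shows "f \<in> borel_measurable (Pi\<^sub>M I \<mu>)"
  using assms
proof (induction I arbitrary: f rule: finite_induct)
  case empty
  then show ?case by (auto simp: space_PiM sets_PiM_empty measurable_def)
next
  case (insert i I)
  define g h where "g = (\<lambda>x. f (x(i := 1)) - f (x(i := 0)))" and "h = (\<lambda>x. f (x(i := 0)))"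
  have aff: "affine_coord j g" "affine_coord j h" if "j \<in> I" for j
  proof -
    have j: "affine_coord j f" "i \<noteq> j" using that insert.hyps insert.prems(1) by auto
    show "affine_coord j g" "affine_coord j h"
      unfolding g_def h_def by (intro affine_coord_diff affine_coord_fix j)+
  qed
  have [measurable]: "g \<in> borel_measurable (Pi\<^sub>M I \<mu>)" "h \<in> borel_measurable (Pi\<^sub>M I \<mu>)"
    using aff insert.prems(2) by (auto intro!: insert.IH)
  have [measurable]: "(\<lambda>x. x i) \<in> borel_measurable (Pi\<^sub>M (insert i I) \<mu>)"
    using measurable_component_singleton[of i "insert i I" \<mu>] insert.prems(2)[of i]
    by (metis insertI1 measurable_cong_sets)
  have [measurable]: "(\<lambda>x. restrict x I) \<in> measurable (Pi\<^sub>M (insert i I) \<mu>) (Pi\<^sub>M I \<mu>)"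
    by (rule measurable_restrict_subset) auto
  have "(\<lambda>x. h (restrict x I) + x i * g (restrict x I)) \<in> borel_measurable (Pi\<^sub>M (insert i I) \<mu>)"
    by measurable
  moreover have "f x = h (restrict x I) + x i * g (restrict x I)"
    if "x \<in> space (Pi\<^sub>M (insert i I) \<mu>)" for x
  proof -
    \<comment> \<open>\<open>restrict x I\<close> forgets \<open>x i\<close>, but \<open>g\<close>
      and \<open>h\<close> overwrite that coordinate before they evaluate \<open>f\<close>.\<close>
    have eq: "(restrict x I)(i := a) = x(i := a)" for a
      using that insert.hyps by (auto simp: fun_eq_iff space_PiM PiE_def extensional_def)
    have "f x = f (x(i := x i))" by simp
    also have "\<dots> = h x + x i * g x"
      unfolding g_def h_def using insert.prems(1) by (intro affine_coordD) auto
    finally show ?thesis by (simp add: g_def h_def eq)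
  qed
  ultimately show ?case by (subst measurable_cong) auto
qed

text \<open>Fubini, one coordinate at a time. With \<open>f x = h x + x i * g x\<close>, induction
  makes \<open>g\<close> or \<open>h\<close> nonzero almost everywhere; the other coordinates being
  fixed, the zero set in \<open>x i\<close> is then empty or a single point, hence null. The point
  \<open>x\<^sub>0\<close> is extensional like the points of the product space, since
  \<open>f\<close> may depend on coordinates outside \<open>I\<close>.\<close>

lemma AE_multiaffine_nonzero:
  fixes \<mu> :: "'i \<Rightarrow> real measure"
  assumes "finite I" and "\<And>i. i \<in> I \<Longrightarrow> affine_coord i f"
    and "x\<^sub>0 \<in> extensional I" "f x\<^sub>0 \<noteq> 0"
    and prob: "\<And>i. prob_space (\<mu> i)" and sets: "\<And>i. sets (\<mu> i) = sets borel"
    and atomless: "\<And>i a. emeasure (\<mu> i) {a} = 0"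
  shows "AE x in Pi\<^sub>M I \<mu>. f x \<noteq> 0"
  using assms(1-4)
proof (induction I arbitrary: f x\<^sub>0 rule: finite_induct)
  case empty
  then show ?case by (auto simp: space_PiM intro!: AE_I2)
next
  case (insert i I)
  interpret product_sigma_finite \<mu>
    using prob by (simp add: product_sigma_finite_def prob_space_imp_sigma_finite)
  define g h where "g = (\<lambda>x. f (x(i := 1)) - f (x(i := 0)))" and "h = (\<lambda>x. f (x(i := 0)))"
  have f_upd: "f (x(i := t)) = h x + t * g x" for x t
    unfolding g_def h_def using insert.prems(1) by (intro affine_coordD) auto
  have aff: "affine_coord j g" "affine_coord j h" if "j \<in> I" for j
  proof -
    have j: "affine_coord j f" "i \<noteq> j" using that insert.hyps insert.prems(1) by auto
    show "affine_coord j g" "affine_coord j h"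
      unfolding g_def h_def by (intro affine_coord_diff affine_coord_fix j)+
  qed
  \<comment> \<open>Points of the smaller product carry \<open>undefined\<close> at
    \<open>i\<close>. As \<open>g\<close> and \<open>h\<close> ignore that coordinate, they take the
    same values at \<open>x\<^sub>1\<close> as at \<open>x\<^sub>0\<close>.\<close>
  define x\<^sub>1 where "x\<^sub>1 = x\<^sub>0(i := undefined)"
  have x1: "x\<^sub>1 \<in> extensional I" using insert.prems(2) by (auto simp: x\<^sub>1_def extensional_def)
  have "f x\<^sub>0 = h x\<^sub>1 + x\<^sub>0 i * g x\<^sub>1"
    using f_upd[of x\<^sub>1 "x\<^sub>0 i"] by (simp add: x\<^sub>1_def)
  with insert.prems(3) have "g x\<^sub>1 \<noteq> 0 \<or> h x\<^sub>1 \<noteq> 0" by auto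
  then have gh: "AE x in Pi\<^sub>M I \<mu>. g x \<noteq> 0 \<or> h x \<noteq> 0"
  proof
    assume "g x\<^sub>1 \<noteq> 0"
    from insert.IH[OF aff(1) x1 this] show ?thesis by auto
  next
    assume "h x\<^sub>1 \<noteq> 0"
    from insert.IH[OF aff(2) x1 this] show ?thesis by auto
  qed
  have zeros: "emeasure (\<mu> i) {t. h x + t * g x = 0} = 0" if "g x \<noteq> 0 \<or> h x \<noteq> 0" for x
  proof (cases "g x = 0")
    case True
    then show ?thesis using that by simp
  next
    case False
    then have "{t. h x + t * g x = 0} = {- h x / g x}" by (auto simp: field_simps add_eq_0_iff)
    then show ?thesis by (simp add: atomless)
  qed
  have f_meas [measurable]: "f \<in> borel_measurable (Pi\<^sub>M (insert i I) \<mu>)"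
    using insert.hyps(1) insert.prems(1) sets by (intro measurable_multiaffine) auto
  define Z where "Z = {x \<in> space (Pi\<^sub>M (insert i I) \<mu>). f x = 0}"
  have Z [measurable]: "Z \<in> sets (Pi\<^sub>M (insert i I) \<mu>)" unfolding Z_def by measurable
  have inner: "(\<integral>\<^sup>+ t. indicator Z (x(i := t)) \<partial>\<mu> i) = emeasure (\<mu> i) {t. h x + t * g x = 0}"
    if "x \<in> space (Pi\<^sub>M I \<mu>)" for x
  proof -
    have sp: "space (\<mu> j) = UNIV" for j using sets_eq_imp_space_eq[OF sets[of j]] by simp
    have "x(i := t) \<in> space (Pi\<^sub>M (insert i I) \<mu>)" for t
      using that by (auto simp: space_PiM PiE_def extensional_def sp)
    then have "indicator Z (x(i := t)) = (indicator {t. h x + t * g x = 0} t :: ennreal)" for t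
      by (simp add: Z_def indicator_def f_upd)
    moreover have "{t. h x + t * g x = 0} \<in> sets (\<mu> i)" unfolding sets by measurable
    ultimately show ?thesis by simp
  qed
  have "emeasure (Pi\<^sub>M (insert i I) \<mu>) Z = (\<integral>\<^sup>+ x. indicator Z x \<partial>Pi\<^sub>M (insert i I) \<mu>)"
    by simp
  also have "\<dots> = (\<integral>\<^sup>+ x. \<integral>\<^sup>+ t. indicator Z (x(i := t)) \<partial>\<mu> i \<partial>Pi\<^sub>M I \<mu>)"
    by (rule product_nn_integral_insert[OF insert.hyps]) measurable
  also have "\<dots> = (\<integral>\<^sup>+ x. 0 \<partial>Pi\<^sub>M I \<mu>)"
  proof (rule nn_integral_cong_AE)
    show "AE x in Pi\<^sub>M I \<mu>. (\<integral>\<^sup>+ t. indicator Z (x(i := t)) \<partial>\<mu> i) = 0"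
      using gh AE_space by eventually_elim (auto simp: inner zeros)
  qed
  finally have "emeasure (Pi\<^sub>M (insert i I) \<mu>) Z = 0" by simp
  then show ?case
    by (intro AE_I[OF _ _ Z]) (auto simp: Z_def)
qed

text \<open>Independence turns the joint law into the product of the marginals, and a density makes
  each marginal atomless.\<close>

lemma (in prob_space) AE_multiaffine_indep_nonzero:
  fixes X :: "'i \<Rightarrow> 'a \<Rightarrow> real"
  assumes "finite I" and "\<And>i. i \<in> I \<Longrightarrow> affine_coord i f"
    and "x\<^sub>0 \<in> extensional I" "f x\<^sub>0 \<noteq> 0"
    and indep: "indep_vars (\<lambda>_. borel) X I"
    and density: "\<And>i. i \<in> I \<Longrightarrow> distributed M lborel (X i) (p i)"
  shows "AE \<omega> in M. f (\<lambda>i\<in>I. X i \<omega>) \<noteq> 0"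
proof (cases "I = {}")
  case True
  then show ?thesis using assms(3,4) by (auto simp: restrict_def)
next
  case False
  then obtain k where k: "k \<in> I" by blast
  \<comment> \<open>The product lemma asks for an atomless probability measure at every index, so
    indices outside \<open>I\<close> borrow the law of \<open>X k\<close>.\<close>
  define \<mu> where "\<mu> i = distr M borel (X (if i \<in> I then i else k))" for i
  have rv: "random_variable borel (X i)" if "i \<in> I" for i
    using indep that by (auto simp: indep_vars_def)
  have atomless: "emeasure (distr M borel (X i)) {a} = 0" if "i \<in> I" for i a
  proof -
    have "emeasure (distr M borel (X i)) {a} = emeasure M (X i -` {a} \<inter> space M)"
      using rv[OF that] by (intro emeasure_distr) auto
    also have "\<dots> = (\<integral>\<^sup>+ x. p i x * indicator {a} x \<partial>lborel)"
      by (rule distributed_emeasure[OF density[OF that]]) auto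
    also have "\<dots> = 0"
      using AE_lborel_singleton[of a] by (subst nn_integral_0_iff_AE)
        (use distributed_borel_measurable[OF density[OF that]] in \<open>auto simp: indicator_def elim!: eventually_mono\<close>)
    finally show ?thesis .
  qed
  have "AE x in Pi\<^sub>M I \<mu>. f x \<noteq> 0"
    using assms(1-4) k rv atomless
    by (intro AE_multiaffine_nonzero[of I f x\<^sub>0]) (auto simp: \<mu>_def intro!: prob_space_distr)
  also have "Pi\<^sub>M I \<mu> = Pi\<^sub>M I (\<lambda>i. distr M borel (X i))"
    by (intro PiM_cong) (auto simp: \<mu>_def)
  also have "\<dots> = distr M (Pi\<^sub>M I (\<lambda>_. borel)) (\<lambda>\<omega>. \<lambda>i\<in>I. X i \<omega>)"
    using indep_vars_iff_distr_eq_PiM'[where I = I and M' = "\<lambda>_. borel" and X = X] False rv indep by simp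
  finally show ?thesis
    by (rule AE_distrD[rotated]) (use rv in \<open>auto intro!: measurable_restrict\<close>)
qed

subsection \<open>Block structure of location and measurement matrices\<close>

lemma block_index_less:
  fixes j n :: nat
  assumes "j < J" "n < N"
  shows "j * N + n < J * N"
proof -
  have "j * N + n < (j + 1) * N" using assms by simp
  also have "\<dots> \<le> J * N" using assms by (intro mult_right_mono) auto
  finally show ?thesis .
qed

lemma unit_vec_append_zero:
  "k < m \<Longrightarrow> unit_vec m k @\<^sub>v 0\<^sub>v n = (unit_vec (m + n) k :: 'a :: semiring_1 vec)"
  by (rule eq_vecI) (auto simp: unit_vec_def)

lemma zero_append_unit_vec:
  "k < n \<Longrightarrow> 0\<^sub>v m @\<^sub>v unit_vec n k = (unit_vec (m + n) (m + k) :: 'a :: semiring_1 vec)"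
  by (rule eq_vecI) (auto simp: unit_vec_def)

lemma cols_four_block_mat:
  assumes "A \<in> carrier_mat r p" "B \<in> carrier_mat r q"
    "C \<in> carrier_mat s p" "D \<in> carrier_mat s q"
  shows "cols (four_block_mat A B C D) =
    map (\<lambda>j. col A j @\<^sub>v col C j) [0..<p] @ map (\<lambda>j. col B j @\<^sub>v col D j) [0..<q]"
proof (rule nth_equalityI)
  show "length (cols (four_block_mat A B C D)) = length
    (map (\<lambda>j. col A j @\<^sub>v col C j) [0..<p] @ map (\<lambda>j. col B j @\<^sub>v col D j) [0..<q])"
    using assms by simp
  fix i assume "i < length (cols (four_block_mat A B C D))"
  then have i: "i < p + q" using assms by simp
  then show "cols (four_block_mat A B C D) ! i =
    (map (\<lambda>j. col A j @\<^sub>v col C j) [0..<p] @ map (\<lambda>j. col B j @\<^sub>v col D j) [0..<q]) ! i"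
    using assms col_four_block_mat[OF assms, of i]
    by (cases "i < p") (auto simp: nth_append)
qed

lemma cols_append_cols:
  assumes "dim_row A = dim_row B"
  shows "cols (append_cols A B) = cols A @ cols B"
proof -
  have "cols (append_cols A B) =
    map (\<lambda>j. col A j @\<^sub>v col (0\<^sub>m 0 (dim_col A)) j) [0..<dim_col A] @
    map (\<lambda>j. col B j @\<^sub>v col (0\<^sub>m 0 (dim_col B)) j) [0..<dim_col B]"
    unfolding append_cols_def
    by (rule cols_four_block_mat[where r = "dim_row A" and s = 0]) (auto simp: assms)
  also have "\<dots> = cols A @ cols B"
    by (auto simp: cols_def intro!: eq_vecI)
  finally show ?thesis .
qed

lemma stack_copies_carrier: "stack_copies J A \<in> carrier_mat (J * dim_row A) (dim_col A)"
  unfolding stack_copies_def by (induction J) auto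

lemma stack_copies_index:
  assumes "r < J * dim_row A" "c < dim_col A"
  shows "stack_copies J A $$ (r, c) = A $$ (r mod dim_row A, c)"
  using assms(1)
proof (induction J arbitrary: r)
  case (Suc J)
  have "stack_copies (Suc J) A = A @\<^sub>r stack_copies J A" by (simp add: stack_copies_def)
  then show ?case
    using Suc.prems Suc.IH[of "r - dim_row A"] assms(2) stack_copies_carrier[of J A]
    by (auto simp: append_rows_def le_mod_geq)
qed simp

lemma dim_diag_block_mat_upt:
  "dim_row (diag_block_mat (map A [0..<J])) = (\<Sum>j<J. dim_row (A j))"
  "dim_col (diag_block_mat (map A [0..<J])) = (\<Sum>j<J. dim_col (A j))"
  by (simp_all add: dim_diag_block_mat o_def interv_sum_list_conv_sum_set_nat atLeast0LessThan)

text \<open>Columns carry labels: \<open>(None, n)\<close> is the common column at coordinate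
  \<open>n\<close>, with a 1 in every block, and \<open>(Some j, n)\<close> is the innovation column
  of sensor \<open>j\<close> at \<open>n\<close>. Coordinate \<open>m\<close> of sensor
  \<open>j\<close> sits in row \<open>j * N + m\<close>.\<close>

fun column_vec :: "nat \<Rightarrow> nat \<Rightarrow> nat option \<times> nat \<Rightarrow> real vec" where
  "column_vec J N (None, n) = vec (J * N) (\<lambda>r. if r mod N = n then 1 else 0)"
| "column_vec J N (Some j, n) = unit_vec (J * N) (j * N + n)"

lemma column_vec_index:
  assumes "j < J" "m < N" "n < N"
  shows "column_vec J N (ow, n) $ (j * N + m) = (if m = n \<and> (ow = None \<or> ow = Some j) then 1 else 0)"
proof -
  have eq: "j * N + m = i * N + n \<longleftrightarrow> j = i \<and> m = n" for i
  proof
    assume "j * N + m = i * N + n"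
    then have "(j * N + m) div N = (i * N + n) div N" "(j * N + m) mod N = (i * N + n) mod N" by simp_all
    then show "j = i \<and> m = n" using assms by simp
  qed simp
  show ?thesis
    using block_index_less[OF assms(1,2)] assms eq by (cases ow) (auto simp: unit_vec_def)
qed

lemma dim_column_vec [simp]: "dim_vec (column_vec J N d) = J * N"
  by (cases "(J, N, d)" rule: column_vec.cases) auto

text \<open>Replaces columns by the list of their coordinates, which is what the later counting is
  about.\<close>

lemma identity_submatrix_cols:
  assumes "identity_submatrix N A"
  shows "\<exists>ns. set ns \<subseteq> {..<N} \<and> distinct ns \<and> cols A = map (unit_vec N) ns"
proof -
  have "set (cols A) \<subseteq> unit_vec N ` {..<N}"
  proof
    fix v assume "v \<in> set (cols A)"
    then have "v \<in> set (cols (1\<^sub>m N :: real mat))" using assms by (auto simp: identity_submatrix_def)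
    then show "v \<in> unit_vec N ` {..<N}" by (auto simp: cols_def)
  qed
  then have "\<forall>v\<in>set (cols A). \<exists>n. n < N \<and> v = unit_vec N n" by auto
  then obtain g where g: "\<forall>v\<in>set (cols A). g v < N \<and> v = unit_vec N (g v)" by metis
  define ns where "ns = map g (cols A)"
  have ns: "set ns \<subseteq> {..<N}" "cols A = map (unit_vec N) ns"
    using g by (auto simp: ns_def o_def intro!: map_idI[symmetric])
  moreover have "distinct ns" using assms ns(2) by (simp add: identity_submatrix_def distinct_map)
  ultimately show ?thesis by blast
qed

text \<open>Induction on the number of blocks: a new last block pads the old columns with zeros
  below, while its own unit vectors are shifted down by \<open>J * N\<close>.\<close>

lemma cols_diag_block_mat_unit:
  fixes A :: "nat \<Rightarrow> 'a :: semiring_1 mat"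
  assumes "\<And>j. j < J \<Longrightarrow> dim_row (A j) = N"
    and "\<And>j. j < J \<Longrightarrow> set (ns j) \<subseteq> {..<N} \<and> cols (A j) = map (unit_vec N) (ns j)"
  shows "cols (diag_block_mat (map A [0..<J])) =
    concat (map (\<lambda>j. map (\<lambda>n. unit_vec (J * N) (j * N + n)) (ns j)) [0..<J])"
  using assms
proof (induction J)
  case (Suc J)
  let ?D = "diag_block_mat (map A [0..<J])"
  have rowD: "dim_row ?D = J * N"
    using Suc.prems(1) by (simp add: dim_diag_block_mat_upt)
  have IH: "cols ?D = concat (map (\<lambda>j. map (\<lambda>n. unit_vec (J * N) (j * N + n)) (ns j)) [0..<J])"
    using Suc by simp
  have "cols (diag_block_mat (map A [0..<Suc J])) =
    map (\<lambda>c. col ?D c @\<^sub>v col (0\<^sub>m N (dim_col ?D)) c) [0..<dim_col ?D] @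
    map (\<lambda>c. col (0\<^sub>m (J * N) (dim_col (A J))) c @\<^sub>v col (A J) c) [0..<dim_col (A J)]"
    using Suc.prems(1)[of J] rowD
    by (simp add: diag_block_mat_last Let_def,
        subst cols_four_block_mat[where r = "J * N" and s = N and p = "dim_col ?D" and q = "dim_col (A J)"]) auto
  also have "map (\<lambda>c. col ?D c @\<^sub>v col (0\<^sub>m N (dim_col ?D)) c) [0..<dim_col ?D] =
    map (\<lambda>v. v @\<^sub>v 0\<^sub>v N) (cols ?D)"
    by (simp add: cols_def)
  also have "\<dots> = concat (map (\<lambda>j. map (\<lambda>n. unit_vec (Suc J * N) (j * N + n)) (ns j)) [0..<J])"
  proof -
    have "unit_vec (J * N) (j * N + n) @\<^sub>v 0\<^sub>v N = (unit_vec (Suc J * N) (j * N + n) :: 'a vec)"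
      if "j < J" "n \<in> set (ns j)" for j n
    proof -
      have "n < N" using that Suc.prems(2)[of j] by auto
      then have "j * N + n < J * N" using that by (intro block_index_less)
      from unit_vec_append_zero[OF this] show ?thesis by (simp add: add.commute)
    qed
    then show ?thesis unfolding IH by (auto simp: map_concat o_def intro!: arg_cong[where f = concat])
  qed
  also have "map (\<lambda>c. col (0\<^sub>m (J * N) (dim_col (A J))) c @\<^sub>v col (A J) c) [0..<dim_col (A J)] =
    map (\<lambda>v. 0\<^sub>v (J * N) @\<^sub>v v) (cols (A J))"
    by (simp add: cols_def)
  also have "\<dots> = map (\<lambda>n. unit_vec (Suc J * N) (J * N + n)) (ns J)"
    using Suc.prems(2)[of J] by (auto simp: zero_append_unit_vec add.commute)
  finally show ?case by simp
qed (simp add: cols_def)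

lemma location_matrix_cols:
  assumes "is_location J N P"
    and "cols (common P) = map (unit_vec N) nc" "set nc \<subseteq> {..<N}"
    and "\<And>j. j < J \<Longrightarrow> set (ns j) \<subseteq> {..<N} \<and> cols (innov P j) = map (unit_vec N) (ns j)"
  shows "cols (location_matrix J P) =
      map (column_vec J N) (map (Pair None) nc @ concat (map (\<lambda>j. map (Pair (Some j)) (ns j)) [0..<J]))"
    and "dim_row (location_matrix J P) = J * N"
proof -
  have rows: "dim_row (common P) = N" "\<And>j. j < J \<Longrightarrow> dim_row (innov P j) = N"
    using assms(1) by (auto simp: is_location_def identity_submatrix_def)
  have stack: "dim_row (stack_copies J (common P)) = J * N"
    "dim_col (stack_copies J (common P)) = dim_col (common P)"
    using carrier_matD[OF stack_copies_carrier[of J "common P"]] rows by simp_all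
  have diag: "dim_row (diag_block_mat (map (innov P) [0..<J])) = J * N"
    using rows by (simp add: dim_diag_block_mat_upt)
  show "dim_row (location_matrix J P) = J * N"
    by (simp add: location_matrix_def append_cols_def stack)
  have "cols (stack_copies J (common P)) = map (\<lambda>n. column_vec J N (None, n)) nc"
  proof (rule nth_equalityI)
    have len: "length nc = dim_col (common P)" using assms(2) by (metis cols_length length_map)
    show "length (cols (stack_copies J (common P))) = length (map (\<lambda>n. column_vec J N (None, n)) nc)"
      using stack len by simp
    fix c assume "c < length (cols (stack_copies J (common P)))"
    then have c: "c < dim_col (common P)" using stack by simp
    have colc: "col (common P) c = unit_vec N (nc ! c)"
      using assms(2) c len by (metis cols_nth cols_length nth_map)
    have "col (stack_copies J (common P)) c = column_vec J N (None, nc ! c)"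
    proof (rule eq_vecI)
      fix r assume "r < dim_vec (column_vec J N (None, nc ! c))"
      then have r: "r < J * N" by simp
      then have "0 < N" by (cases N) auto
      have "col (stack_copies J (common P)) c $ r = stack_copies J (common P) $$ (r, c)"
        using r c stack by simp
      also have "\<dots> = common P $$ (r mod N, c)"
        using stack_copies_index[of r J "common P" c] r c rows(1) by simp
      also have "\<dots> = col (common P) c $ (r mod N)" using c rows(1) \<open>0 < N\<close> by simp
      also have "\<dots> = column_vec J N (None, nc ! c) $ r"
        using r \<open>0 < N\<close> by (simp add: colc unit_vec_def)
      finally show "col (stack_copies J (common P)) c $ r = column_vec J N (None, nc ! c) $ r" .
    qed (simp add: stack)
    then show "cols (stack_copies J (common P)) ! c = map (\<lambda>n. column_vec J N (None, n)) nc ! c"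
      using c len stack by simp
  qed
  moreover have "cols (diag_block_mat (map (innov P) [0..<J])) =
    concat (map (\<lambda>j. map (\<lambda>n. unit_vec (J * N) (j * N + n)) (ns j)) [0..<J])"
    using rows(2) assms(4) by (rule cols_diag_block_mat_unit)
  ultimately show "cols (location_matrix J P) =
      map (column_vec J N) (map (Pair None) nc @ concat (map (\<lambda>j. map (Pair (Some j)) (ns j)) [0..<J]))"
    unfolding location_matrix_def
    by (subst cols_append_cols) (simp_all add: stack diag map_concat o_def)
qed

lemma distinct_location_columns:
  assumes "distinct nc" "\<And>j. j < J \<Longrightarrow> distinct (ns j)"
  shows "distinct (map (Pair None) nc @ concat (map (\<lambda>j. map (Pair (Some j)) (ns j)) [0..<J]))"
  using assms(2)
  by (induction J) (use assms(1) in \<open>auto simp: distinct_map inj_on_def\<close>)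

text \<open>Linear independence speaks of the set of columns, so repeated columns have to be
  excluded first. A maximal independent subset of that set has \<open>dim_col A\<close> elements by
  the rank assumption, which leaves no room for repetitions.\<close>

lemma full_column_rank_kernel:
  assumes "full_column_rank A" "v \<in> carrier_vec (dim_col A)" "A *\<^sub>v v = 0\<^sub>v (dim_row A)"
  shows "v = 0\<^sub>v (dim_col A)"
proof -
  interpret vec_space "TYPE(real)" "dim_row A" .
  have A: "A \<in> carrier_mat (dim_row A) (dim_col A)" by simp
  have rank: "rank A = dim_col A" using assms(1) by (simp add: full_column_rank_def)
  obtain S where S: "maximal S (\<lambda>T. T \<subseteq> set (cols A) \<and> lin_indpt T)"
    using maximal_exists[of "(\<lambda>T. T \<subseteq> set (cols A) \<and> lin_indpt T)" "card (set (cols A))" "{}"]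
    by (meson List.finite_set card_mono empty_iff empty_subsetI finite_lin_indpt2 rev_finite_subset)
  then have "card S \<le> card (set (cols A))" by (simp add: card_mono maximal_def)
  then have "dim_col A \<le> card (set (cols A))" using rank rank_card_indpt[OF A S] by simp
  then have "distinct (cols A)" by (metis card_distinct card_length cols_length le_antisym)
  then show ?thesis
    using full_rank_lin_indpt[OF A rank] lin_depI[OF A assms(2) _ assms(3)] by blast
qed

text \<open>Induction on \<open>J\<close> splits \<open>w\<close> into its first
  \<open>J * N\<close> and its last \<open>N\<close> entries; the off-diagonal zero blocks
  contribute nothing, so the last block kills the tail and the others kill the rest.\<close>

lemma diag_block_mat_kernel:
  fixes A :: "nat \<Rightarrow> 'a :: comm_ring_1 mat"
  assumes "\<And>j. j < J \<Longrightarrow> A j \<in> carrier_mat (M j) N" and "w \<in> carrier_vec (J * N)"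
    and "diag_block_mat (map A [0..<J]) *\<^sub>v w = 0\<^sub>v (\<Sum>j<J. M j)"
    and "j < J" "i < M j"
  shows "(\<Sum>n<N. A j $$ (i, n) * w $ (j * N + n)) = 0"
  using assms
proof (induction J arbitrary: w)
  case (Suc J)
  let ?D = "diag_block_mat (map A [0..<J])"
  have D: "?D \<in> carrier_mat (\<Sum>j<J. M j) (J * N)"
  proof -
    have "dim_row (A j) = M j" "dim_col (A j) = N" if "j < J" for j
      using Suc.prems(1)[of j] that by (simp_all add: carrier_matD)
    then show ?thesis by (intro carrier_matI) (simp_all add: dim_diag_block_mat_upt)
  qed
  have AJ: "A J \<in> carrier_mat (M J) N" using Suc.prems(1) by simp
  define u v where "u = vec_first w (J * N)" and "v = vec_last w N"
  have uv: "u \<in> carrier_vec (J * N)" "v \<in> carrier_vec N" "w = u @\<^sub>v v"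
    using Suc.prems(2) by (simp_all add: u_def v_def add.commute)
  have "diag_block_mat (map A [0..<Suc J]) *\<^sub>v w = ?D *\<^sub>v u @\<^sub>v A J *\<^sub>v v"
  proof -
    have "four_block_mat ?D (0\<^sub>m (dim_row ?D) (dim_col (A J))) (0\<^sub>m (dim_row (A J)) (dim_col ?D)) (A J) *\<^sub>v (u @\<^sub>v v) =
      (?D *\<^sub>v u + 0\<^sub>m (dim_row ?D) (dim_col (A J)) *\<^sub>v v) @\<^sub>v (0\<^sub>m (dim_row (A J)) (dim_col ?D) *\<^sub>v u + A J *\<^sub>v v)"
      using D AJ uv by (intro four_block_mat_mult_vec) auto
    also have "0\<^sub>m (dim_row ?D) (dim_col (A J)) *\<^sub>v v = 0\<^sub>v (dim_row ?D)"
      using AJ uv by (intro eq_vecI) auto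
    also have "0\<^sub>m (dim_row (A J)) (dim_col ?D) *\<^sub>v u = 0\<^sub>v (dim_row (A J))"
      using D uv by (intro eq_vecI) auto
    also have "?D *\<^sub>v u + 0\<^sub>v (dim_row ?D) = ?D *\<^sub>v u" using D uv by simp
    also have "0\<^sub>v (dim_row (A J)) + A J *\<^sub>v v = A J *\<^sub>v v" using AJ uv by simp
    finally show ?thesis by (simp add: diag_block_mat_last Let_def uv(3))
  qed
  moreover have "0\<^sub>v (\<Sum>j<Suc J. M j) = 0\<^sub>v (\<Sum>j<J. M j) @\<^sub>v (0\<^sub>v (M J) :: 'a vec)"
    by (auto intro!: eq_vecI)
  ultimately have eq: "?D *\<^sub>v u @\<^sub>v A J *\<^sub>v v = 0\<^sub>v (\<Sum>j<J. M j) @\<^sub>v 0\<^sub>v (M J)" using Suc.prems(3) by simp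
  have "?D *\<^sub>v u \<in> carrier_vec (\<Sum>j<J. M j)" using D uv(1) by (rule mult_mat_vec_carrier)
  from append_vec_eq[OF this zero_carrier_vec] eq
  have zero: "?D *\<^sub>v u = 0\<^sub>v (\<Sum>j<J. M j)" "A J *\<^sub>v v = 0\<^sub>v (M J)" by blast+
  show ?case
  proof (cases "j = J")
    case True
    have "0 = (A J *\<^sub>v v) $ i" using zero(2) Suc.prems(5) True by simp
    also have "\<dots> = (\<Sum>n<N. A J $$ (i, n) * v $ n)"
      using AJ uv Suc.prems(5) True by (simp add: scalar_prod_def atLeast0LessThan)
    also have "\<dots> = (\<Sum>n<N. A J $$ (i, n) * w $ (J * N + n))"
      using uv by (intro sum.cong) auto
    finally show ?thesis using True by simp
  next
    case False
    then have j: "j < J" using Suc.prems(4) by simp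
    have "(\<Sum>n<N. A j $$ (i, n) * u $ (j * N + n)) = 0"
      using Suc.IH[OF _ uv(1) zero(1) j Suc.prems(5)] Suc.prems(1) by simp
    moreover have "u $ (j * N + n) = w $ (j * N + n)" if "n < N" for n
      using block_index_less[OF j that] uv by auto
    ultimately show ?thesis by simp
  qed
qed simp

subsection \<open>Square submatrices of the measured location matrix\<close>

text \<open>The three matrices agree outside row \<open>r\<close>, so their cofactors along that row
  coincide and Laplace expansion there is affine in \<open>t\<close>.\<close>

lemma det_affine_row:
  fixes A\<^sub>0 A\<^sub>1 A\<^sub>t :: "'a :: comm_ring_1 mat"
  assumes carrier: "A\<^sub>0 \<in> carrier_mat n n" "A\<^sub>1 \<in> carrier_mat n n" "A\<^sub>t \<in> carrier_mat n n" and r: "r < n"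
    and rest: "\<And>i c. i < n \<Longrightarrow> c < n \<Longrightarrow> i \<noteq> r \<Longrightarrow>
      A\<^sub>1 $$ (i, c) = A\<^sub>0 $$ (i, c) \<and> A\<^sub>t $$ (i, c) = A\<^sub>0 $$ (i, c)"
    and row: "\<And>c. c < n \<Longrightarrow> A\<^sub>t $$ (r, c) = A\<^sub>0 $$ (r, c) + t * (A\<^sub>1 $$ (r, c) - A\<^sub>0 $$ (r, c))"
  shows "det A\<^sub>t = det A\<^sub>0 + t * (det A\<^sub>1 - det A\<^sub>0)"
proof -
  have "mat_delete A\<^sub>1 r c = mat_delete A\<^sub>0 r c" "mat_delete A\<^sub>t r c = mat_delete A\<^sub>0 r c"
    if "c < n" for c
    using that r carrier rest by (auto simp: mat_delete_def intro!: eq_matI)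
  then have cof: "cofactor A\<^sub>1 r c = cofactor A\<^sub>0 r c" "cofactor A\<^sub>t r c = cofactor A\<^sub>0 r c"
    if "c < n" for c
    using that by (simp_all add: cofactor_def)
  show ?thesis
    unfolding laplace_expansion_row[OF carrier(1) r] laplace_expansion_row[OF carrier(2) r]
      laplace_expansion_row[OF carrier(3) r] sum_subtractf[symmetric] sum_distrib_left sum.distrib[symmetric]
    by (intro sum.cong refl) (simp add: cof row algebra_simps)
qed

text \<open>Row \<open>r\<close> is the row of \<Phi>\<open>L\<close> that belongs to measurement
  \<open>snd (\<mu> r)\<close> of sensor \<open>fst (\<mu> r)\<close>, with the free point
  \<open>x\<close> in place of the entries of \<Phi>. Since \<Phi> is block diagonal, only the
  \<open>N\<close> rows of \<open>L\<close> in the block of that sensor enter.\<close>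

definition selected_rows ::
  "nat \<Rightarrow> real mat \<Rightarrow> (nat \<Rightarrow> nat \<times> nat) \<Rightarrow> (nat \<times> nat \<times> nat \<Rightarrow> real) \<Rightarrow> real mat" where
  "selected_rows N L \<mu> x = mat (dim_col L) (dim_col L) (\<lambda>(r, c).
     \<Sum>n<N. x (fst (\<mu> r), snd (\<mu> r), n) * L $$ (fst (\<mu> r) * N + n, c))"

text \<open>Associativity (\<Phi>\<open>L\<close>)\<open>v\<close> = \<Phi>(\<open>L v\<close>),
  read off in one selected row.\<close>

lemma selected_rows_mult:
  assumes L: "dim_row L = J * N" and v: "v \<in> carrier_vec (dim_col L)"
    and r: "r < dim_col L" "fst (\<mu> r) < J"
  shows "(selected_rows N L \<mu> x *\<^sub>v v) $ r =
    (\<Sum>n<N. x (fst (\<mu> r), snd (\<mu> r), n) * (L *\<^sub>v v) $ (fst (\<mu> r) * N + n))"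
proof -
  let ?j = "fst (\<mu> r)" and ?i = "snd (\<mu> r)"
  have "(selected_rows N L \<mu> x *\<^sub>v v) $ r =
    (\<Sum>c<dim_col L. (\<Sum>n<N. x (?j, ?i, n) * L $$ (?j * N + n, c)) * v $ c)"
    using v r by (simp add: selected_rows_def scalar_prod_def atLeast0LessThan)
  also have "\<dots> = (\<Sum>c<dim_col L. \<Sum>n<N. x (?j, ?i, n) * (L $$ (?j * N + n, c) * v $ c))"
    by (simp add: sum_distrib_right mult.assoc)
  also have "\<dots> = (\<Sum>n<N. x (?j, ?i, n) * (\<Sum>c<dim_col L. L $$ (?j * N + n, c) * v $ c))"
    by (subst sum.swap) (simp add: sum_distrib_left)
  also have "\<dots> = (\<Sum>n<N. x (?j, ?i, n) * (L *\<^sub>v v) $ (?j * N + n))"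
    using v block_index_less[OF r(2)] L
    by (intro sum.cong) (auto simp: scalar_prod_def atLeast0LessThan)
  finally show ?thesis .
qed

text \<open>The variable at \<open>(j, i, n)\<close> occurs only in rows whose measurement is
  \<open>(j, i)\<close>. Injectivity allows at most one such row, and the determinant is affine in a
  single row.\<close>

lemma affine_coord_det_selected_rows:
  assumes inj: "inj_on \<mu> {..<dim_col L}"
  shows "affine_coord q (\<lambda>x. det (selected_rows N L \<mu> x))"
  unfolding affine_coord_def
proof (intro allI)
  fix x t
  let ?S = "\<lambda>s. selected_rows N L \<mu> (x(q := s))"
  obtain j i n where q: "q = (j, i, n)" by (cases q)
  have carrier: "?S s \<in> carrier_mat (dim_col L) (dim_col L)" for s by (simp add: selected_rows_def)
  have other: "?S s $$ (r, c) = ?S 0 $$ (r, c)" if "r < dim_col L" "c < dim_col L" "\<mu> r \<noteq> (j, i)" for r c s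
    using that by (auto simp: selected_rows_def q prod_eq_iff intro!: sum.cong)
  show "det (?S t) = det (?S 0) + t * (det (?S 1) - det (?S 0))"
  proof (cases "\<exists>r<dim_col L. \<mu> r = (j, i)")
    case False
    then have "?S s = ?S 0" for s
      by (intro eq_matI other) (auto simp: carrier_matD[OF carrier])
    from this[of t] this[of 1] show ?thesis by simp
  next
    case True
    then obtain r where r: "r < dim_col L" "\<mu> r = (j, i)" by blast
    show ?thesis
    proof (rule det_affine_row[OF carrier carrier carrier r(1)])
      fix r' c assume "r' < dim_col L" "c < dim_col L" "r' \<noteq> r"
      moreover from this have "\<mu> r' \<noteq> (j, i)" using inj r by (metis inj_onD lessThan_iff)
      ultimately show "?S 1 $$ (r', c) = ?S 0 $$ (r', c) \<and> ?S t $$ (r', c) = ?S 0 $$ (r', c)"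
        using other by blast
    next
      fix c assume c: "c < dim_col L"
      have "(x(q := t)) p = (x(q := 0)) p + t * ((x(q := 1)) p - (x(q := 0)) p)" for p by simp
      then have "?S t $$ (r, c) = (\<Sum>k<N. ((x(q := 0)) (j, i, k) + t * ((x(q := 1)) (j, i, k) - (x(q := 0)) (j, i, k))) * L $$ (j * N + k, c))"
        using r c by (simp add: selected_rows_def del: fun_upd_apply)
      also have "\<dots> = ?S 0 $$ (r, c) + t * (?S 1 $$ (r, c) - ?S 0 $$ (r, c))"
      proof -
        have "?S s $$ (r, c) = (\<Sum>k<N. (x(q := s)) (j, i, k) * L $$ (j * N + k, c))" for s
          using r c by (simp add: selected_rows_def del: fun_upd_apply)
        then show ?thesis
          by (simp only: sum_distrib_left sum_subtractf[symmetric] sum.distrib[symmetric])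
            (intro sum.cong refl, simp only: algebra_simps)
      qed
      finally show "?S t $$ (r, c) = ?S 0 $$ (r, c) + t * (?S 1 $$ (r, c) - ?S 0 $$ (r, c))" .
    qed
  qed
qed

fun reaches :: "nat \<Rightarrow> (nat \<Rightarrow> nat set) \<Rightarrow> nat option \<times> nat \<Rightarrow> nat set" where
  "reaches J S (None, n) = {j. j < J \<and> n \<notin> S j}"
| "reaches J S (Some j, n) = {j}"

text \<open>To check Hall's condition for a nonempty set \<open>V\<close> of labels, let \<Gamma> be
  the set of sensors reached by \<open>V\<close>; by \<open>uncovered\<close> it is nonempty. Then
  \<open>V\<close> consists of innovation columns of sensors in \<Gamma> and of common columns
  overlapping an innovation at every sensor outside \<Gamma>. The assumption \<open>rows\<close>
  bounds their number by the number of measurements taken in \<Gamma>, all of which are available to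
  \<open>V\<close>.\<close>

lemma column_matching:
  fixes C :: "nat set" and S :: "nat \<Rightarrow> nat set"
  assumes finC: "finite C" and finS: "\<And>j. j < J \<Longrightarrow> finite (S j)"
    and uncovered: "\<And>n. n \<in> C \<Longrightarrow> \<exists>j<J. n \<notin> S j"
    and rows: "\<And>\<Gamma>. \<Gamma> \<subseteq> {..<J} \<Longrightarrow> \<Gamma> \<noteq> {} \<Longrightarrow>
      (\<Sum>j\<in>\<Gamma>. card (S j)) + card {n \<in> C. \<forall>j\<in>{..<J} - \<Gamma>. n \<in> S j} \<le> (\<Sum>j\<in>\<Gamma>. M j)"
  defines "D \<equiv> Pair None ` C \<union> (\<Union>j<J. Pair (Some j) ` S j)"
  shows "\<exists>\<mu>. inj_on \<mu> D \<and> (\<forall>d\<in>D. fst (\<mu> d) \<in> reaches J S d \<and> snd (\<mu> d) < M (fst (\<mu> d)))"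
proof -
  have finD: "finite D" using finC finS by (auto simp: D_def)
  have reach: "reaches J S d \<subseteq> {..<J}" "reaches J S d \<noteq> {}" if "d \<in> D" for d
    using that uncovered by (fastforce simp: D_def)+
  have finR: "finite (reaches J S d)" if "d \<in> D" for d
    using reach(1)[OF that] finite_subset by blast
  have "card V \<le> card (\<Union>d\<in>V. SIGMA j:reaches J S d. {..<M j})" if V: "V \<subseteq> D" for V
  proof (cases "V = {}")
    case False
    define \<Gamma> where "\<Gamma> = (\<Union>d\<in>V. reaches J S d)"
    have \<Gamma>: "\<Gamma> \<subseteq> {..<J}" "\<Gamma> \<noteq> {}" using reach V False by (fastforce simp: \<Gamma>_def)+
    have fin\<Gamma>: "finite \<Gamma>" using \<Gamma>(1) finite_subset by blast
    define Q where "Q = {n \<in> C. \<forall>j\<in>{..<J} - \<Gamma>. n \<in> S j}"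
    have finQ: "finite Q" using finC by (simp add: Q_def)
    have "V \<subseteq> (\<Union>j\<in>\<Gamma>. Pair (Some j) ` S j) \<union> Pair None ` Q"
    proof
      fix d assume d: "d \<in> V"
      then have "d \<in> D" using V by blast
      moreover have sub: "reaches J S d \<subseteq> \<Gamma>" using d by (auto simp: \<Gamma>_def)
      ultimately consider n where "d = (None, n)" "n \<in> C" | j n where "d = (Some j, n)" "n \<in> S j"
        by (auto simp: D_def)
      then show "d \<in> (\<Union>j\<in>\<Gamma>. Pair (Some j) ` S j) \<union> Pair None ` Q"
      proof cases
        case (1 n)
        \<comment> \<open>All sensors without an innovation at \<open>n\<close> are reached, so they
          lie in \<Gamma>.\<close>
        then have "n \<in> Q" using sub by (auto simp: Q_def)
        then show ?thesis using 1 by simp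
      next
        case (2 j n)
        then show ?thesis using sub by auto
      qed
    qed
    then have "card V \<le> card ((\<Union>j\<in>\<Gamma>. Pair (Some j) ` S j) \<union> Pair None ` Q)"
      using fin\<Gamma> finQ finS \<Gamma>(1) by (intro card_mono) auto
    also have "\<dots> \<le> card (\<Union>j\<in>\<Gamma>. Pair (Some j) ` S j) + card (Pair None ` Q :: (nat option \<times> nat) set)"
      by (rule card_Un_le)
    also have "\<dots> \<le> (\<Sum>j\<in>\<Gamma>. card (Pair (Some j) ` S j)) + card Q"
      using fin\<Gamma> finQ by (intro add_mono card_UN_le card_image_le)
    also have "(\<Sum>j\<in>\<Gamma>. card (Pair (Some j) ` S j)) = (\<Sum>j\<in>\<Gamma>. card (S j))"
      by (intro sum.cong card_image) (auto simp: inj_on_def)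
    also have "\<dots> + card Q \<le> (\<Sum>j\<in>\<Gamma>. M j)"
      using rows[OF \<Gamma>] by (simp add: Q_def)
    also have "\<dots> = card (SIGMA j:\<Gamma>. {..<M j})" using fin\<Gamma> by simp
    also have "(SIGMA j:\<Gamma>. {..<M j}) = (\<Union>d\<in>V. SIGMA j:reaches J S d. {..<M j})"
      by (auto simp: \<Gamma>_def)
    finally show ?thesis .
  qed simp
  from hall_marriage[OF finD _ this] finR
  obtain \<mu> where "inj_on \<mu> D" "\<forall>d\<in>D. \<mu> d \<in> (SIGMA j:reaches J S d. {..<M j})"
    by (metis (no_types, lifting) finite_SigmaI finite_lessThan)
  then show ?thesis by (intro exI[of _ \<mu>]) (fastforce simp: mem_Sigma_iff)
qed

section \<open>Location matrices described by their column labels\<close>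

lemma sum_index_list:
  assumes "distinct ds"
  shows "(\<Sum>c<length ds. f (ds ! c)) = sum f (set ds)"
  using sum.reindex_bij_betw[OF bij_betw_nth[OF assms refl refl], of f] by simp

lemma location_columns:
  assumes "is_location J N P"
  obtains nc ns ds where "set nc \<subseteq> {..<N}" "distinct nc" "cols (common P) = map (unit_vec N) nc"
    and "\<And>j. j < J \<Longrightarrow> set (ns j) \<subseteq> {..<N} \<and> distinct (ns j) \<and> cols (innov P j) = map (unit_vec N) (ns j)"
    and "distinct ds" "set ds = Pair None ` set nc \<union> (\<Union>j<J. Pair (Some j) ` set (ns j))"
    and "dim_row (location_matrix J P) = J * N" "cols (location_matrix J P) = map (column_vec J N) ds"
proof -
  obtain nc where nc: "set nc \<subseteq> {..<N}" "distinct nc" "cols (common P) = map (unit_vec N) nc"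
    using identity_submatrix_cols assms unfolding is_location_def by blast
  have "\<forall>j. \<exists>ns. j < J \<longrightarrow> set ns \<subseteq> {..<N} \<and> distinct ns \<and> cols (innov P j) = map (unit_vec N) ns"
    using identity_submatrix_cols assms unfolding is_location_def by blast
  then obtain ns where ns: "\<forall>j<J. set (ns j) \<subseteq> {..<N} \<and> distinct (ns j) \<and> cols (innov P j) = map (unit_vec N) (ns j)"
    by metis
  define ds where "ds = map (Pair None) nc @ concat (map (\<lambda>j. map (Pair (Some j)) (ns j)) [0..<J])"
  have "distinct ds" unfolding ds_def using nc ns by (intro distinct_location_columns) auto
  moreover have "set ds = Pair None ` set nc \<union> (\<Union>j<J. Pair (Some j) ` set (ns j))"
    by (auto simp: ds_def)
  moreover have "dim_row (location_matrix J P) = J * N" "cols (location_matrix J P) = map (column_vec J N) ds"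
    using location_matrix_cols[OF assms nc(3,1), of ns] ns by (auto simp: ds_def)
  ultimately show ?thesis using that[of nc ns ds] nc ns by blast
qed

text \<open>This is \<open>x_j = z_C + z_j\<close> in coordinate \<open>m\<close>: the row has ones
  exactly in the columns labelled \<open>(None, m)\<close> and \<open>(Some j, m)\<close>.
  Intersecting with \<open>set ds\<close> drops a label that does not occur, and writing
  \<open>v\<close> through \<open>f\<close> turns the sum over positions into one over
  labels.\<close>

lemma location_matrix_mult_index:
  assumes L: "dim_row L = J * N" "cols L = map (column_vec J N) ds" and "distinct ds"
    and ds: "\<And>d. d \<in> set ds \<Longrightarrow> snd d < N"
    and f: "v = vec (length ds) (\<lambda>c. f (ds ! c))" and j: "j < J" "m < N"
  shows "(L *\<^sub>v v) $ (j * N + m) = sum f (set ds \<inter> {(None, m), (Some j, m)})"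
proof -
  have K: "dim_col L = length ds" using L(2) by (metis cols_length length_map)
  have entry: "L $$ (j * N + m, c) = (if ds ! c \<in> {(None, m), (Some j, m)} then 1 else 0)"
    if c: "c < length ds" for c
  proof -
    obtain ow n where d: "ds ! c = (ow, n)" by (cases "ds ! c")
    have "n < N" using ds[OF nth_mem[OF c]] d by simp
    have "L $$ (j * N + m, c) = cols L ! c $ (j * N + m)"
      using c K L(1) block_index_less[OF j] by simp
    also have "\<dots> = column_vec J N (ow, n) $ (j * N + m)" using c d by (simp add: L(2))
    also have "\<dots> = (if ds ! c \<in> {(None, m), (Some j, m)} then 1 else 0)"
      using column_vec_index[OF j \<open>n < N\<close>] d by auto
    finally show ?thesis .
  qed
  have "(L *\<^sub>v v) $ (j * N + m) = (\<Sum>c<length ds. L $$ (j * N + m, c) * f (ds ! c))"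
    using K L(1) block_index_less[OF j] f by (simp add: scalar_prod_def atLeast0LessThan)
  also have "\<dots> = (\<Sum>c<length ds. if ds ! c \<in> {(None, m), (Some j, m)} then f (ds ! c) else 0)"
    by (intro sum.cong refl) (simp add: entry)
  also have "\<dots> = (\<Sum>d\<in>set ds. if d \<in> {(None, m), (Some j, m)} then f d else 0)"
    by (rule sum_index_list[OF \<open>distinct ds\<close>])
  also have "\<dots> = sum f (set ds \<inter> {(None, m), (Some j, m)})"
    by (rule sum.inter_restrict[symmetric]) simp
  finally show ?thesis .
qed

text \<open>
  A coordinate that is common and belongs to every innovation block would make the common column
  the sum of \<open>J\<close> innovation columns.
\<close>

lemma full_rank_private_sensor:
  assumes L: "dim_row L = J * N" "cols L = map (column_vec J N) ds" and dist: "distinct ds"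
    and ds: "\<And>d. d \<in> set ds \<Longrightarrow> snd d < N"
    and rank: "full_column_rank L" and n: "(None, n) \<in> set ds"
  shows "\<exists>j<J. (Some j, n) \<notin> set ds"
proof (rule ccontr)
  assume "\<not> ?thesis"
  then have all: "(Some j, n) \<in> set ds" if "j < J" for j using that by blast
  have K: "dim_col L = length ds" using L(2) by (metis cols_length length_map)
  \<comment> \<open>The relation has coefficient 1 at the common column of \<open>n\<close>, -1 at
    every innovation column of \<open>n\<close>, and 0 elsewhere.\<close>
  define f :: "nat option \<times> nat \<Rightarrow> real"
    where "f d = (if snd d = n then if fst d = None then 1 else - 1 else 0)" for d
  define v where "v = vec (length ds) (\<lambda>c. f (ds ! c))"
  have "L *\<^sub>v v = 0\<^sub>v (dim_row L)"
  proof (rule eq_vecI)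
    fix r assume "r < dim_vec (0\<^sub>v (dim_row L) :: real vec)"
    then have r: "r < J * N" using L by simp
    then have "0 < N" by (cases N) auto
    define j m where "j = r div N" and "m = r mod N"
    have jm: "j < J" "m < N" "r = j * N + m"
      using r \<open>0 < N\<close> by (simp_all add: j_def m_def less_mult_imp_div_less)
    have "(L *\<^sub>v v) $ r = sum f (set ds \<inter> {(None, m), (Some j, m)})"
      unfolding jm(3) by (rule location_matrix_mult_index[OF L dist ds v_def jm(1,2)])
    also have "\<dots> = 0"
    proof (cases "m = n")
      case True
      then have "set ds \<inter> {(None, m), (Some j, m)} = {(None, n), (Some j, n)}"
        using n all[OF jm(1)] by auto
      then show ?thesis by (simp add: f_def)
    next
      case False
      then show ?thesis by (intro sum.neutral) (auto simp: f_def)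
    qed
    finally show "(L *\<^sub>v v) $ r = 0\<^sub>v (dim_row L) $ r" using r L by simp
  qed simp
  then have v0: "v = 0\<^sub>v (dim_col L)"
    using K by (intro full_column_rank_kernel[OF rank]) (auto simp: v_def)
  obtain c where "c < length ds" "ds ! c = (None, n)" using n by (metis in_set_conv_nth)
  then have "v $ c = 1" by (simp add: v_def f_def)
  then show False using v0 K \<open>c < length ds\<close> by simp
qed

text \<open>
  Letting each selected measurement read exactly the coordinate of the column it is matched to,
  common columns are read at a sensor where no innovation interferes; so the common part
  of a kernel vector vanishes first, and then the innovations.
\<close>

lemma selected_rows_nonsingular_witness:
  assumes L: "dim_row L = J * N" "cols L = map (column_vec J N) ds" and dist: "distinct ds"
    and ds: "\<And>d. d \<in> set ds \<Longrightarrow> snd d < N"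
    and inj: "inj_on \<mu> (set ds)"
    and common: "\<And>n. (None, n) \<in> set ds \<Longrightarrow>
      fst (\<mu> (None, n)) < J \<and> (Some (fst (\<mu> (None, n))), n) \<notin> set ds"
    and innov: "\<And>j n. (Some j, n) \<in> set ds \<Longrightarrow> j < J \<and> fst (\<mu> (Some j, n)) = j"
    and x: "\<And>d n. d \<in> set ds \<Longrightarrow> n < N \<Longrightarrow>
      x (fst (\<mu> d), snd (\<mu> d), n) = (if \<exists>d'\<in>set ds. \<mu> d' = \<mu> d \<and> snd d' = n then 1 else 0)"
  shows "det (selected_rows N L (\<lambda>c. \<mu> (ds ! c)) x) \<noteq> 0"
proof
  let ?B = "selected_rows N L (\<lambda>c. \<mu> (ds ! c)) x"
  have K: "dim_col L = length ds" using L(2) by (metis cols_length length_map)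
  have B: "?B \<in> carrier_mat (length ds) (length ds)" by (simp add: selected_rows_def K)
  assume "det ?B = 0"
  then obtain v where v: "v \<in> carrier_vec (length ds)" "v \<noteq> 0\<^sub>v (length ds)" "?B *\<^sub>v v = 0\<^sub>v (length ds)"
    using det_0_iff_vec_prod_zero_field[OF B] by blast
  \<comment> \<open>\<open>f\<close> reads the entries of \<open>v\<close> by label instead of by
    position.\<close>
  define f where "f d = v $ (inv_into {..<length ds} ((!) ds) d)" for d
  have inj_ds: "inj_on ((!) ds) {..<length ds}" using dist by (simp add: inj_on_nth)
  have f_nth: "f (ds ! c) = v $ c" if "c < length ds" for c
    using inv_into_f_f[OF inj_ds, of c] that by (simp add: f_def)
  have vf: "v = vec (length ds) (\<lambda>c. f (ds ! c))"
    using v(1) f_nth by (intro eq_vecI) auto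
  have sensor: "fst (\<mu> d) < J" if "d \<in> set ds" for d
    using that common innov by (cases "(J, (\<lambda>_. {}) :: nat \<Rightarrow> nat set, d)" rule: reaches.cases) auto
  \<comment> \<open>The measurement matched to \<open>d\<close> sees only coordinate
    \<open>snd d\<close> of its sensor, where at most one common and one innovation column
    contribute.\<close>
  have eq: "sum f (set ds \<inter> {(None, snd d), (Some (fst (\<mu> d)), snd d)}) = 0" if d: "d \<in> set ds" for d
  proof -
    obtain c where c: "c < length ds" "ds ! c = d" using d by (metis in_set_conv_nth)
    have "0 = (?B *\<^sub>v v) $ c" using v(3) c by simp
    also have "\<dots> = (\<Sum>n<N. x (fst (\<mu> d), snd (\<mu> d), n) * (L *\<^sub>v v) $ (fst (\<mu> d) * N + n))"
      using selected_rows_mult[OF L(1), of v c "\<lambda>c. \<mu> (ds ! c)" x] v(1) c sensor[OF d] K by simp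
    \<comment> \<open>By injectivity \<open>d\<close> is the only label matched to this measurement,
      so the row of \<open>x\<close> is a unit vector.\<close>
    also have "\<dots> = (\<Sum>n<N. if n = snd d then (L *\<^sub>v v) $ (fst (\<mu> d) * N + n) else 0)"
      using d inj by (intro sum.cong refl) (auto simp: x dest: inj_onD)
    also have "\<dots> = (L *\<^sub>v v) $ (fst (\<mu> d) * N + snd d)" using ds[OF d] by simp
    also have "\<dots> = sum f (set ds \<inter> {(None, snd d), (Some (fst (\<mu> d)), snd d)})"
      by (rule location_matrix_mult_index[OF L dist ds vf sensor[OF d] ds[OF d]])
    finally show ?thesis by simp
  qed
  have f_common: "f (None, n) = 0" if "(None, n) \<in> set ds" for n
  proof -
    have "set ds \<inter> {(None, n), (Some (fst (\<mu> (None, n))), n)} = {(None, n)}"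
      using that common by auto
    then show ?thesis using eq[OF that] by simp
  qed
  have f_innov: "f (Some j, n) = 0" if "(Some j, n) \<in> set ds" for j n
  proof (cases "(None, n) \<in> set ds")
    case True
    then have "set ds \<inter> {(None, n), (Some j, n)} = {(None, n), (Some j, n)}" using that by auto
    then show ?thesis using eq[OF that] innov[OF that] f_common[OF True] by simp
  next
    case False
    then have "set ds \<inter> {(None, n), (Some j, n)} = {(Some j, n)}" using that by auto
    then show ?thesis using eq[OF that] innov[OF that] by simp
  qed
  have f_zero: "f d = 0" if "d \<in> set ds" for d
    using that f_common f_innov by (metis not_None_eq surj_pair)
  have "v $ c = 0" if "c < length ds" for c
    using f_nth[OF that] f_zero[OF nth_mem[OF that]] by simp
  then have "v = 0\<^sub>v (length ds)" using v(1) by (intro eq_vecI) auto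
  then show False using v(2) by blast
qed

text \<open>The convention for the full set of sensors agrees with the general count, because no
  sensor is left outside \<Gamma>. The convention for the empty set need not agree, hence the
  restriction to nonempty \<Gamma>.\<close>

lemma overlap_size_eq_card:
  assumes nc: "set nc \<subseteq> {..<N}" "distinct nc" "cols (common P) = map (unit_vec N) nc"
    and ns: "\<And>j. j < J \<Longrightarrow> set (ns j) \<subseteq> {..<N} \<and> cols (innov P j) = map (unit_vec N) (ns j)"
    and \<Gamma>: "\<Gamma> \<noteq> {}"
  shows "overlap_size J N \<Gamma> P = card {n \<in> set nc. \<forall>j\<in>{..<J} - \<Gamma>. n \<in> set (ns j)}"
proof (cases "\<Gamma> = {..<J}")
  case True
  have "dim_col (common P) = card (set nc)"
    using nc by (metis cols_length distinct_card length_map)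
  then show ?thesis using \<Gamma> True by (simp add: overlap_size_def)
next
  case False
  have mem: "(unit_vec N n :: real vec) \<in> unit_vec N ` A \<longleftrightarrow> n \<in> A"
    if "n < N" for n and A :: "nat set"
    using unit_vec_eq[OF that, where 'a = real] by (auto simp: image_iff)
  have "{n. n < N \<and> unit_vec N n \<in> set (cols (common P)) \<and>
      (\<forall>j\<in>{..<J} - \<Gamma>. unit_vec N n \<in> set (cols (innov P j)))} =
    {n \<in> set nc. \<forall>j\<in>{..<J} - \<Gamma>. n \<in> set (ns j)}"
    using nc ns by (auto simp: mem)
  then show ?thesis using \<Gamma> False by (simp add: overlap_size_def)
qed

section \<open>Almost sure uniqueness of the solution\<close>

theorem theorem3:
  fixes \<Omega> :: "'w measure"
    and J N :: nat
    and M :: "nat \<Rightarrow> nat"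
    and \<P> :: "location set"
    and X :: "real vec"
    and \<Phi> :: "nat \<Rightarrow> 'w \<Rightarrow> real mat"
    and P :: location
  assumes "prob_space \<Omega>"
    and "0 < J"
    and "joint_sparsity_model J N \<P>"
    and "X \<in> carrier_vec (J * N)"
    and "obtained_from J \<P> X"
    and "gaussian_measurements \<Omega> J N M \<Phi>"
    and "P \<in> feasible_locations J \<P> X"
    and "full_column_rank (location_matrix J P)"
    and "\<And>\<Gamma>. \<Gamma> \<subseteq> {..<J} \<Longrightarrow> (\<Sum>j\<in>\<Gamma>. M j) \<ge> cond_sparsity J N \<Gamma> P"
  shows "AE \<omega> in \<Omega>.
    (let Y = measurement_matrix J \<Phi> \<omega> *\<^sub>v X;
         A = measurement_matrix J \<Phi> \<omega> * location_matrix J P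
     in (\<exists>!\<Theta>. \<Theta> \<in> carrier_vec (dim_col (location_matrix J P)) \<and> Y = A *\<^sub>v \<Theta>) \<and>
        (\<forall>\<Theta> \<in> carrier_vec (dim_col (location_matrix J P)).
           Y = A *\<^sub>v \<Theta> \<longrightarrow> X = location_matrix J P *\<^sub>v \<Theta>))"
proof -
  interpret prob_space \<Omega> by fact
  define L where "L = location_matrix J P"
  have loc: "is_location J N P"
    using assms(3,7) by (auto simp: joint_sparsity_model_def feasible_locations_def)
  obtain nc ns ds where nc: "set nc \<subseteq> {..<N}" "distinct nc" "cols (common P) = map (unit_vec N) nc"
    and ns: "\<And>j. j < J \<Longrightarrow> set (ns j) \<subseteq> {..<N} \<and> distinct (ns j) \<and> cols (innov P j) = map (unit_vec N) (ns j)"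
    and dist: "distinct ds" and set_ds: "set ds = Pair None ` set nc \<union> (\<Union>j<J. Pair (Some j) ` set (ns j))"
    and L: "dim_row L = J * N" "cols L = map (column_vec J N) ds"
    by (rule location_columns[OF loc, folded L_def]) (rule that)
  have K: "dim_col L = length ds" using L(2) by (metis cols_length length_map)
  have ds: "snd d < N" if "d \<in> set ds" for d using that nc(1) ns by (fastforce simp: set_ds)
  \<comment> \<open>This representation of \<open>X\<close> solves the system for every outcome, so
    only uniqueness is probabilistic.\<close>
  obtain \<Theta>\<^sub>0 where \<Theta>\<^sub>0: "\<Theta>\<^sub>0 \<in> carrier_vec (dim_col L)" "X = L *\<^sub>v \<Theta>\<^sub>0"
    using assms(7) by (auto simp: feasible_locations_def generates_def L_def)

  \<comment> \<open>Full rank takes the place of an inequality for the empty set: every common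
    coordinate has a sensor without an innovation there.\<close>
  have "\<exists>j<J. n \<notin> set (ns j)" if "n \<in> set nc" for n
    using full_rank_private_sensor[OF L dist ds, of n] assms(8) that by (auto simp: L_def set_ds)
  moreover have "(\<Sum>j\<in>\<Gamma>. card (set (ns j))) + card {n \<in> set nc. \<forall>j\<in>{..<J} - \<Gamma>. n \<in> set (ns j)} \<le> (\<Sum>j\<in>\<Gamma>. M j)"
    if \<Gamma>: "\<Gamma> \<subseteq> {..<J}" "\<Gamma> \<noteq> {}" for \<Gamma>
  proof -
    have "dim_col (innov P j) = card (set (ns j))" if "j \<in> \<Gamma>" for j
      using ns that \<Gamma>(1) by (metis cols_length distinct_card length_map lessThan_iff subsetD)
    then show ?thesis
      using assms(9)[OF \<Gamma>(1)] overlap_size_eq_card[OF nc _ \<Gamma>(2), of J ns] ns \<Gamma>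
      by (simp add: cond_sparsity_def)
  qed
  ultimately have "\<exists>\<mu>. inj_on \<mu> (set ds) \<and>
      (\<forall>d\<in>set ds. fst (\<mu> d) \<in> reaches J (\<lambda>j. set (ns j)) d \<and> snd (\<mu> d) < M (fst (\<mu> d)))"
    unfolding set_ds by (intro column_matching) auto
  then obtain \<mu> where inj: "inj_on \<mu> (set ds)"
    and \<mu>: "\<And>d. d \<in> set ds \<Longrightarrow> fst (\<mu> d) \<in> reaches J (\<lambda>j. set (ns j)) d \<and> snd (\<mu> d) < M (fst (\<mu> d))"
    by blast
  have common: "fst (\<mu> (None, n)) < J \<and> (Some (fst (\<mu> (None, n))), n) \<notin> set ds"
    if "(None, n) \<in> set ds" for n
    using \<mu>[OF that] by (auto simp: set_ds)
  have innov: "j < J \<and> fst (\<mu> (Some j, n)) = j" if "(Some j, n) \<in> set ds" for j n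
    using \<mu>[OF that] that by (auto simp: set_ds)
  have sensor: "fst (\<mu> d) < J" if "d \<in> set ds" for d
    using that common innov by (metis not_None_eq surj_pair)

  define I where "I = {(j, i, n). j < J \<and> i < M j \<and> n < N}"
  have "I \<subseteq> (SIGMA j:{..<J}. {..<M j} \<times> {..<N})" by (auto simp: I_def)
  then have finI: "finite I" by (rule finite_subset) auto
  define B where "B = selected_rows N L (\<lambda>c. \<mu> (ds ! c))"
  have "inj_on (\<lambda>c. \<mu> (ds ! c)) {..<dim_col L}"
  proof (rule inj_onI)
    fix c c' assume "c \<in> {..<dim_col L}" "c' \<in> {..<dim_col L}" and eq: "\<mu> (ds ! c) = \<mu> (ds ! c')"
    then have less: "c < length ds" "c' < length ds" using K by simp_all
    then show "c = c'"
      using inj_onD[OF inj eq nth_mem[OF less(1)] nth_mem[OF less(2)]] nth_eq_iff_index_eq[OF dist] by simp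
  qed
  then have affine: "affine_coord q (\<lambda>x. det (B x))" for q
    unfolding B_def by (rule affine_coord_det_selected_rows)
  \<comment> \<open>The 0/1 choice of \<Phi>: the measurement matched to \<open>d\<close> reads
    exactly coordinate \<open>snd d\<close>. The restriction to \<open>I\<close> makes the point
    extensional.\<close>
  define x\<^sub>0 :: "nat \<times> nat \<times> nat \<Rightarrow> real" where
    "x\<^sub>0 = restrict (\<lambda>(j, i, n). if \<exists>d\<in>set ds. \<mu> d = (j, i) \<and> snd d = n then 1 else 0) I"
  have witness: "det (B x\<^sub>0) \<noteq> 0"
    unfolding B_def using \<mu> sensor
    by (intro selected_rows_nonsingular_witness[OF L dist ds inj common innov])
      (auto simp: x\<^sub>0_def I_def)

  have gauss: "\<And>j \<omega>. j < J \<Longrightarrow> \<omega> \<in> space \<Omega> \<Longrightarrow> \<Phi> j \<omega> \<in> carrier_mat (M j) N"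
    "indep_vars (\<lambda>_. borel) (\<lambda>(j, i, n) \<omega>. \<Phi> j \<omega> $$ (i, n)) I"
    using assms(6) by (auto simp: gaussian_measurements_def I_def)
  \<comment> \<open>With \<open>j < J\<close> below the existential quantifier, the standard
    deviations can be chosen as one total function of the sensor.\<close>
  have "\<forall>j. \<exists>\<sigma>. j < J \<longrightarrow> (\<forall>i<M j. \<forall>n<N.
      distributed \<Omega> lborel (\<lambda>\<omega>. \<Phi> j \<omega> $$ (i, n)) (normal_density 0 \<sigma>))"
    using assms(6) unfolding gaussian_measurements_def by blast
  then obtain \<sigma> where \<sigma>: "\<And>j i n. j < J \<Longrightarrow> i < M j \<Longrightarrow> n < N \<Longrightarrow>
      distributed \<Omega> lborel (\<lambda>\<omega>. \<Phi> j \<omega> $$ (i, n)) (normal_density 0 (\<sigma> j))"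
    by metis
  have "AE \<omega> in \<Omega>. det (B (\<lambda>q\<in>I. (\<lambda>(j, i, n) \<omega>. \<Phi> j \<omega> $$ (i, n)) q \<omega>)) \<noteq> 0"
    using \<sigma>
    by (intro AE_multiaffine_indep_nonzero[where x\<^sub>0 = x\<^sub>0 and p = "\<lambda>(j, i, n). normal_density 0 (\<sigma> j)"]
        finI affine witness gauss(2)) (auto simp: x\<^sub>0_def I_def)
  \<comment> \<open>What remains is linear algebra at one outcome whose selected determinant is
    nonzero.\<close>
  then show ?thesis
    using AE_space
  proof eventually_elim
    case (elim \<omega>)
    define F where "F = measurement_matrix J \<Phi> \<omega>"
    define x where "x = (\<lambda>q\<in>I. (\<lambda>(j, i, n) \<omega>. \<Phi> j \<omega> $$ (i, n)) q \<omega>)"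
    have \<Phi>: "\<Phi> j \<omega> \<in> carrier_mat (M j) N" if "j < J" for j using gauss(1) that elim(2) by blast
    have dims: "dim_row (\<Phi> j \<omega>) = M j" "dim_col (\<Phi> j \<omega>) = N" if "j < J" for j
      using carrier_matD[OF \<Phi>[OF that]] .
    have F: "F \<in> carrier_mat (\<Sum>j<J. M j) (J * N)"
      using dims by (intro carrier_matI) (simp_all add: F_def measurement_matrix_def dim_diag_block_mat_upt)
    have L_carrier: "L \<in> carrier_mat (J * N) (dim_col L)" using L(1) by auto
    have B_carrier: "B x \<in> carrier_mat (dim_col L) (dim_col L)" by (simp add: B_def selected_rows_def)
    \<comment> \<open>A kernel vector of \<open>F * L\<close> is annihilated by every measurement,
      in particular by the matched ones. These form the nonsingular matrix \<open>B x\<close>, so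
      the vector is zero.\<close>
    have kernel: "v = 0\<^sub>v (dim_col L)"
      if v: "v \<in> carrier_vec (dim_col L)" "(F * L) *\<^sub>v v = 0\<^sub>v (\<Sum>j<J. M j)" for v
    proof -
      have Lv: "L *\<^sub>v v \<in> carrier_vec (J * N)" using L_carrier v(1) by (rule mult_mat_vec_carrier)
      have "F *\<^sub>v (L *\<^sub>v v) = 0\<^sub>v (\<Sum>j<J. M j)"
        using v assoc_mult_mat_vec[OF F L_carrier v(1)] by simp
      then have FLv: "diag_block_mat (map (\<lambda>j. \<Phi> j \<omega>) [0..<J]) *\<^sub>v (L *\<^sub>v v) = 0\<^sub>v (\<Sum>j<J. M j)"
        by (simp add: F_def measurement_matrix_def)
      have zero: "(\<Sum>n<N. \<Phi> j \<omega> $$ (i, n) * (L *\<^sub>v v) $ (j * N + n)) = 0" if "j < J" "i < M j" for i j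
        using diag_block_mat_kernel[where A = "\<lambda>j. \<Phi> j \<omega>", OF _ Lv FLv that] \<Phi> by blast
      have "B x *\<^sub>v v = 0\<^sub>v (dim_col L)"
      proof (rule eq_vecI)
        fix r assume "r < dim_vec (0\<^sub>v (dim_col L) :: real vec)"
        then have r: "r < dim_col L" by simp
        then have d: "ds ! r \<in> set ds" using K by simp
        obtain j i where ji: "\<mu> (ds ! r) = (j, i)" by (cases "\<mu> (ds ! r)")
        then have less: "j < J" "i < M j" using \<mu>[OF d] sensor[OF d] by auto
        have "(B x *\<^sub>v v) $ r = (\<Sum>n<N. x (j, i, n) * (L *\<^sub>v v) $ (j * N + n))"
          using selected_rows_mult[OF L(1) v(1) r, of "\<lambda>c. \<mu> (ds ! c)" x] ji less by (simp add: B_def)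
        \<comment> \<open>The matched pair \<open>(j, i)\<close> is a genuine measurement, so the
          indices lie in \<open>I\<close> and \<open>x\<close> holds the actual entries of
          \<Phi>.\<close>
        also have "\<dots> = (\<Sum>n<N. \<Phi> j \<omega> $$ (i, n) * (L *\<^sub>v v) $ (j * N + n))"
          using less by (intro sum.cong) (auto simp: x_def I_def)
        finally show "(B x *\<^sub>v v) $ r = 0\<^sub>v (dim_col L) $ r" using zero[OF less] r by simp
      qed (use B_carrier in auto)
      then show ?thesis
        using det_0_iff_vec_prod_zero_field[OF B_carrier] elim(1) v(1) by (auto simp: x_def)
    qed
    have unique: "\<Theta> = \<Theta>\<^sub>0"
      if \<Theta>: "\<Theta> \<in> carrier_vec (dim_col L)" "F *\<^sub>v X = (F * L) *\<^sub>v \<Theta>" for \<Theta>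
    proof -
      have FL: "F * L \<in> carrier_mat (\<Sum>j<J. M j) (dim_col L)" using F L_carrier by (rule mult_carrier_mat)
      have "(F * L) *\<^sub>v \<Theta> = (F * L) *\<^sub>v \<Theta>\<^sub>0"
        using \<Theta>(2) \<Theta>\<^sub>0 assoc_mult_mat_vec[OF F L_carrier \<Theta>\<^sub>0(1)] by simp
      then have "(F * L) *\<^sub>v (\<Theta> - \<Theta>\<^sub>0) = 0\<^sub>v (\<Sum>j<J. M j)"
        using mult_minus_distrib_mat_vec[OF FL \<Theta>(1) \<Theta>\<^sub>0(1)] FL \<Theta>\<^sub>0(1) by simp
      then have diff: "\<Theta> - \<Theta>\<^sub>0 = 0\<^sub>v (dim_col L)"
        by (rule kernel[OF minus_carrier_vec[OF \<Theta>(1) \<Theta>\<^sub>0(1)]])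
      have "\<Theta> $ c = \<Theta>\<^sub>0 $ c" if "c < dim_col L" for c
        using arg_cong[OF diff, of "\<lambda>u. u $ c"] that \<Theta>\<^sub>0(1) by simp
      then show ?thesis using \<Theta>(1) \<Theta>\<^sub>0(1) by (intro eq_vecI) auto
    qed
    have "F *\<^sub>v X = (F * L) *\<^sub>v \<Theta>\<^sub>0"
      using \<Theta>\<^sub>0 assoc_mult_mat_vec[OF F L_carrier \<Theta>\<^sub>0(1)] by simp
    \<comment> \<open>Every solution equals \<open>\<Theta>\<^sub>0\<close>, which also gives the
      recovery of \<open>X\<close>.\<close>
    then show ?case
      using unique \<Theta>\<^sub>0 unfolding Let_def F_def[symmetric] L_def[symmetric] by blast
  qed
qed

end
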